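(* Let $X$ be a regular space and let $\mathcal A$ and $\mathcal B$ be ideals of closed subsets of $X$. Then (i) $\mathsf G_1(\mathcal O_X(\mathcal A), \Lambda_X(\mathcal B)) \leq_{\mathrm{II}} \mathsf G_1(\Omega_{\mathrm{MC}_{\mathcal A}(X),\mathbf 0},\Omega_{\mathrm{MC}_{\mathcal B}(X),\mathbf 0})$; (ii) $\mathsf G_1(\Omega_{\mathrm{MC}_{\mathcal A}(X),\mathbf 0},\Omega_{\mathrm{MC}_{\mathcal B}(X),\mathbf 0}) \leq_{\mathrm{II}} \mathsf G_1(\mathscr D_{\mathrm{MC}_{\mathcal A}(X)},\Omega_{\mathrm{MC}_{\mathcal B}(X),\mathbf 0})$; and (iii) if $X$ is $\mathcal A$-normal, then $\mathsf G_1(\mathscr D_{\mathrm{MC}_{\mathcal A}(X)},\Omega_{\mathrm{MC}_{\mathcal B}(X),\mathbf 0}) \leq_{\mathrm{II}} \mathsf G_1(\mathcal O_X(\mathcal A), \Lambda_X(\mathcal B))$. Thus, if $X$ is $\mathcal A$-normal, the three games are equivalent.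
   Context: Spaces and ideals. All spaces are Hausdorff. An ideal of closed sets of $X$ is a family $\mathcal A$ of non-empty closed subsets of $X$ such that $A\cup B\in\mathcal A$ for $A,B\in\mathcal A$; every non-empty closed subset of a member of $\mathcal A$ is in $\mathcal A$; and $\{x\}\in\mathcal A$ for every $x\in X$. Every ideal of closed sets is assumed not to contain $X$ itself. $X$ is $\mathcal A$-normal if for all $A\in\mathcal A$ and open $U\supseteq A$ there is an open $V$ with $A\subseteq V\subseteq \mathrm{cl}(V)\subseteq U$. Minimal cusco maps. A cusco map $\Phi$ from $X$ to $\mathbb R$ assigns to each $x\in X$ a non-empty compact convex set $\Phi(x)\subseteq\mathbb R$ and is upper semicontinuous: $\{x\in X:\Phi(x)\subseteq V\}$ is open for every open $V\subseteq\mathbb R$. It is minimal if its graph $\{\langle x,y\rangle:y\in\Phi(x)\}$ is $\subseteq$-minimal among graphs of cusco maps from $X$ to $\mathbb R$. $\mathrm{MC}(X)$ is the set of all minimal cusco maps from $X$ to $\mathbb R$; $\mathbf 0\in \mathrm{MC}(X)$ is the map constantly $\{0\}$. For $A\subseteq X$ and $\varepsilon>0$, $\mathbf W(A,\varepsilon)$ is the set of pairs $\langle\Phi,\Psi\rangle$ such that for all $x\in A$, $\Phi(x)\subseteq\bigcup_{y\in\Psi(x)}B(y,\varepsilon)$ and $\Psi(x)\subseteq\bigcup_{y\in\Phi(x)}B(y,\varepsilon)$, where $B(y,\varepsilon)=(y-\varepsilon,y+\varepsilon)$. $\mathrm{MC}_{\mathcal A}(X)$ is $\mathrm{MC}(X)$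 with the topology generated by the uniformity with base $\{\mathbf W(A,\varepsilon):A\in\mathcal A,\varepsilon>0\}$. Collections. An $\mathcal A$-cover of $X$ is an open cover $\mathscr U$ of $X$ with $\emptyset\notin\mathscr U$, $X\notin\mathscr U$ such that every $A\in\mathcal A$ is contained in some $U\in\mathscr U$. $\mathcal O_X(\mathcal A)$ is the set of all $\mathcal A$-covers. $\Lambda_X(\mathcal A)$ is the set of all $\mathcal A$-covers $\mathscr U$ such that $\{U\in\mathscr U:A\subseteq U\}$ is infinite for every $A\in\mathcal A$. For a space $Y$ and $y\in Y$: $\Omega_{Y,y}=\{A\subseteq Y:y\in\mathrm{cl}_Y(A)\}$; $\mathscr D_Y$ is the set of dense subsets of $Y$. Games. In $\mathsf G_1(\mathcal C,\mathcal D)$, in inning $n\in\omega$ One plays $A_n\in\mathcal C$ and Two responds with $x_n\in A_n$; Two wins if $\{x_n:n\in\omega\}\in\mathcal D$, otherwise One wins. $\mathrm I\uparrow\mathcal G$ (resp. $\mathrm{II}\uparrow\mathcal G$): One (resp. Two) has a winning strategy, where strategies may depend on all previous moves of the opponent (for Two, including the current one). $\mathrm I\uparrow_{\mathrm{pre}}\mathcal G$: One has a winning predetermined strategy, i.e. one depending only on $n$. $\mathrm{II}\uparrow_{\mathrm{mark}}\mathcal G$: Two has a winning Markov strategy, i.e. one depending only on One's current move and $n$. A slashed arrow denotes negation. $\mathcal G\leq_{\mathrm{II}}\mathcal H$ means that all four implications hold: $\mathrm{II}\uparrow_{\mathrm{mark}}\mathcal G\Rightarrow\mathrm{II}\uparrow_{\mathrm{mark}}\mathcal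 H$; $\mathrm{II}\uparrow\mathcal G\Rightarrow\mathrm{II}\uparrow\mathcal H$; $\mathrm I\not\uparrow\mathcal G\Rightarrow\mathrm I\not\uparrow\mathcal H$; $\mathrm I\not\uparrow_{\mathrm{pre}}\mathcal G\Rightarrow\mathrm I\not\uparrow_{\mathrm{pre}}\mathcal H$. Games $\mathcal G,\mathcal H$ are equivalent if $\mathcal G\leq_{\mathrm{II}}\mathcal H$ and $\mathcal H\leq_{\mathrm{II}}\mathcal G$. *)

theory Defs
  imports "HOL-Analysis.Analysis"
begin

definition closed_ideal :: "'a::topological_space set set \<Rightarrow> bool" where
  "closed_ideal \<A> \<longleftrightarrow>
     (\<forall>A\<in>\<A>. closed A \<and> A \<noteq> {}) \<and>
     (\<forall>A\<in>\<A>. \<forall>B\<in>\<A>. A \<union> B \<in> \<A>) \<and>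
     (\<forall>A\<in>\<A>. \<forall>B. closed B \<and> B \<noteq> {} \<and> B \<subseteq> A \<longrightarrow> B \<in> \<A>) \<and>
     (\<forall>x. {x} \<in> \<A>) \<and>
     UNIV \<notin> \<A>"

definition ideal_normal :: "'a::topological_space set set \<Rightarrow> bool" where
  "ideal_normal \<A> \<longleftrightarrow>
     (\<forall>A\<in>\<A>. \<forall>U. open U \<and> A \<subseteq> U \<longrightarrow>
        (\<exists>V. open V \<and> A \<subseteq> V \<and> closure V \<subseteq> U))"

definition cusco :: "('a::topological_space \<Rightarrow> real set) \<Rightarrow> bool" where
  "cusco \<Phi> \<longleftrightarrow>
     (\<forall>x. \<Phi> x \<noteq> {} \<and> compact (\<Phi> x) \<and> convex (\<Phi> x)) \<and>
     (\<forall>V. open V \<longrightarrow> open {x. \<Phi> x \<subseteq> V})"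

definition graph :: "('a \<Rightarrow> real set) \<Rightarrow> ('a \<times> real) set" where
  "graph \<Phi> = {(x, y). y \<in> \<Phi> x}"

definition MC :: "('a::topological_space \<Rightarrow> real set) set" where
  "MC = {\<Phi>. cusco \<Phi> \<and> (\<forall>\<Psi>. cusco \<Psi> \<and> graph \<Psi> \<subseteq> graph \<Phi> \<longrightarrow> graph \<Psi> = graph \<Phi>)}"

definition zero_map :: "'a \<Rightarrow> real set" where
  "zero_map = (\<lambda>x. {0})"

definition W :: "'a::topological_space set \<Rightarrow> real \<Rightarrow> (('a \<Rightarrow> real set) \<times> ('a \<Rightarrow> real set)) set" where
  "W A \<epsilon> = {(\<Phi>, \<Psi>). \<Phi> \<in> MC \<and> \<Psi> \<in> MC \<and>
     (\<forall>x\<in>A. \<Phi> x \<subseteq> (\<Union>y\<in>\<Psi> x. ball y \<epsilon>) \<and> \<Psi> x \<subseteq> (\<Union>y\<in>\<Phi> x. ball y \<epsilon>))}"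

text \<open>
  The topology on the carrier \<open>M\<close> induced by the uniformity with base \<open>\<V>\<close>: a set is open iff
  with each point \<open>x\<close> it contains \<open>V[x]\<close> for some basic entourage \<open>V\<close>.
  It is meaningful only if \<open>\<V>\<close> is a base of a uniformity on \<open>M\<close>; for the entourages
  \<open>W A \<epsilon>\<close> of an ideal this is the content of the lemmas below.
\<close>

definition uniform_base_topology :: "'b set \<Rightarrow> ('b \<times> 'b) set set \<Rightarrow> 'b topology" where
  "uniform_base_topology M \<V> =
     topology (\<lambda>S. S \<subseteq> M \<and> (\<forall>x\<in>S. \<exists>V\<in>\<V>. V `` {x} \<subseteq> S))"

definition MC_base :: "'a::topological_space set set
    \<Rightarrow> (('a \<Rightarrow> real set) \<times> ('a \<Rightarrow> real set)) set set" where
  "MC_base \<A> = {W A \<epsilon> |A \<epsilon>. A \<in> \<A> \<and> \<epsilon> > 0}"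

definition MC_top :: "'a::topological_space set set \<Rightarrow> ('a \<Rightarrow> real set) topology" where
  "MC_top \<A> = uniform_base_topology MC (MC_base \<A>)"

lemma W_refl:
  assumes "\<epsilon> > 0"
  shows "Id_on MC \<subseteq> W A \<epsilon>"
proof -
  have "P \<subseteq> (\<Union>y\<in>P. ball y \<epsilon>)" for P :: "real set"
    using assms centre_in_ball by blast
  then show ?thesis unfolding W_def by blast
qed

lemma W_sym: "(W A \<epsilon>)\<inverse> = W A \<epsilon>"
  unfolding W_def by blast

lemma W_subset: "W A \<epsilon> \<subseteq> MC \<times> MC"
  unfolding W_def by blast

lemma W_mono:
  assumes "A \<subseteq> B" and "\<epsilon> \<le> \<delta>"
  shows "W B \<epsilon> \<subseteq> W A \<delta>"
proof (rule subrelI)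
  fix \<Phi> \<Psi> assume h: "(\<Phi>, \<Psi>) \<in> W B \<epsilon>"
  have ball: "(\<Union>y\<in>P. ball y \<epsilon>) \<subseteq> (\<Union>y\<in>P. ball y \<delta>)" for P :: "real set"
    using subset_ball[OF assms(2)] by (rule UN_mono[OF subset_refl])
  have "\<Phi> x \<subseteq> (\<Union>y\<in>\<Psi> x. ball y \<delta>) \<and> \<Psi> x \<subseteq> (\<Union>y\<in>\<Phi> x. ball y \<delta>)" if "x \<in> A" for x
  proof -
    have "x \<in> B" using that assms(1) by (rule rev_subsetD)
    then have "\<Phi> x \<subseteq> (\<Union>y\<in>\<Psi> x. ball y \<epsilon>)" "\<Psi> x \<subseteq> (\<Union>y\<in>\<Phi> x. ball y \<epsilon>)"
      using h by (simp_all add: W_def)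
    then show ?thesis using ball[of "\<Psi> x"] ball[of "\<Phi> x"] by (meson order_trans)
  qed
  then show "(\<Phi>, \<Psi>) \<in> W A \<delta>" using h by (simp add: W_def)
qed

lemma W_Int: "W (A \<union> B) (min \<epsilon> \<delta>) \<subseteq> W A \<epsilon> \<inter> W B \<delta>"
  by (intro Int_greatest W_mono) simp_all

lemma W_half_aux:
  assumes "P \<subseteq> (\<Union>y\<in>Q. ball y (\<epsilon>/2))" "Q \<subseteq> (\<Union>y\<in>R. ball y (\<epsilon>/2))"
  shows "P \<subseteq> (\<Union>y\<in>R. ball (y::real) \<epsilon>)"
proof
  fix p assume "p \<in> P"
  then obtain q where q: "q \<in> Q" "dist q p < \<epsilon>/2" using assms(1) by auto
  then obtain r where r: "r \<in> R" "dist r q < \<epsilon>/2" using assms(2) by auto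
  have "dist r p < \<epsilon>" using q r dist_triangle[of r p q] by linarith
  then show "p \<in> (\<Union>y\<in>R. ball y \<epsilon>)" using r by auto
qed

lemma W_half: "W A (\<epsilon>/2) O W A (\<epsilon>/2) \<subseteq> W A \<epsilon>"
proof clarify
  fix \<Phi> \<Psi> \<Theta> assume h: "(\<Phi>, \<Psi>) \<in> W A (\<epsilon>/2)" "(\<Psi>, \<Theta>) \<in> W A (\<epsilon>/2)"
  have "\<Phi> x \<subseteq> (\<Union>y\<in>\<Theta> x. ball y \<epsilon>) \<and> \<Theta> x \<subseteq> (\<Union>y\<in>\<Phi> x. ball y \<epsilon>)" if "x \<in> A" for x
    using h that W_half_aux[where P = "\<Phi> x" and Q = "\<Psi> x" and R = "\<Theta> x" and \<epsilon> = \<epsilon>] W_half_aux[where P = "\<Theta> x" and Q = "\<Psi> x" and R = "\<Phi> x" and \<epsilon> = \<epsilon>]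
    by (simp add: W_def)
  then show "(\<Phi>, \<Theta>) \<in> W A \<epsilon>" using h by (simp add: W_def)
qed

lemma openin_MC_top:
  assumes "closed_ideal \<A>"
  shows "openin (MC_top \<A>) S \<longleftrightarrow>
     S \<subseteq> MC \<and> (\<forall>\<Phi>\<in>S. \<exists>A\<in>\<A>. \<exists>\<epsilon>>0. W A \<epsilon> `` {\<Phi>} \<subseteq> S)"
proof -
  let ?P = "\<lambda>S. S \<subseteq> MC \<and> (\<forall>\<Phi>\<in>S. \<exists>V\<in>MC_base \<A>. V `` {\<Phi>} \<subseteq> S)"
  have un: "A \<union> B \<in> \<A>" if "A \<in> \<A>" "B \<in> \<A>" for A B
    using assms that unfolding closed_ideal_def by blast
  have base_Int: "\<exists>V\<in>MC_base \<A>. V \<subseteq> V1 \<inter> V2" if V: "V1 \<in> MC_base \<A>" "V2 \<in> MC_base \<A>" for V1 V2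
  proof -
    obtain A \<epsilon> B \<delta> where "V1 = W A \<epsilon>" "V2 = W B \<delta>" "A \<in> \<A>" "B \<in> \<A>" "\<epsilon> > 0" "\<delta> > 0"
      using V by (auto simp: MC_base_def)
    note h = this
    have "A \<union> B \<in> \<A> \<and> min \<epsilon> \<delta> > 0"
      using h un[of A B] by simp
    then have "W (A \<union> B) (min \<epsilon> \<delta>) \<in> MC_base \<A>"
      unfolding MC_base_def by blast
    moreover have "W (A \<union> B) (min \<epsilon> \<delta>) \<subseteq> V1 \<inter> V2"
      using h W_Int[of A B \<epsilon> \<delta>] by simp
    ultimately show ?thesis by blast
  qed
  have "istopology ?P"
    unfolding istopology_def
  proof (intro conjI allI impI)
    fix S T assume S: "?P S" and T: "?P T"
    show "S \<inter> T \<subseteq> MC" using S by blast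
    show "\<forall>\<Phi>\<in>S \<inter> T. \<exists>V\<in>MC_base \<A>. V `` {\<Phi>} \<subseteq> S \<inter> T"
    proof
      fix \<Phi> assume "\<Phi> \<in> S \<inter> T"
      then obtain V1 V2 where V: "V1 \<in> MC_base \<A>" "V2 \<in> MC_base \<A>"
        and "V1 `` {\<Phi>} \<subseteq> S" "V2 `` {\<Phi>} \<subseteq> T"
        using S T by blast
      moreover obtain V where "V \<in> MC_base \<A>" "V \<subseteq> V1 \<inter> V2"
        using base_Int[OF V] by blast
      ultimately show "\<exists>V\<in>MC_base \<A>. V `` {\<Phi>} \<subseteq> S \<inter> T" by blast
    qed
  next
    fix \<K> assume K: "\<forall>S\<in>\<K>. ?P S"
    show "\<Union>\<K> \<subseteq> MC" using K by blast
    show "\<forall>\<Phi>\<in>\<Union>\<K>. \<exists>V\<in>MC_base \<A>. V `` {\<Phi>} \<subseteq> \<Union>\<K>"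
    proof
      fix \<Phi> assume "\<Phi> \<in> \<Union>\<K>"
      then obtain S where "S \<in> \<K>" "\<Phi> \<in> S" by blast
      moreover from this K obtain V where "V \<in> MC_base \<A>" "V `` {\<Phi>} \<subseteq> S" by blast
      ultimately show "\<exists>V\<in>MC_base \<A>. V `` {\<Phi>} \<subseteq> \<Union>\<K>" by blast
    qed
  qed
  then have "openin (MC_top \<A>) S \<longleftrightarrow> ?P S"
    unfolding MC_top_def uniform_base_topology_def by (subst topology_inverse') simp_all
  also have "\<dots> \<longleftrightarrow> S \<subseteq> MC \<and> (\<forall>\<Phi>\<in>S. \<exists>A\<in>\<A>. \<exists>\<epsilon>>0. W A \<epsilon> `` {\<Phi>} \<subseteq> S)"
    unfolding MC_base_def by blast
  finally show ?thesis .
qed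

lemma topspace_MC_top:
  assumes "closed_ideal (\<A> :: 'a::topological_space set set)"
  shows "topspace (MC_top \<A>) = MC"
proof -
  obtain A where "A \<in> \<A>" using assms unfolding closed_ideal_def by blast
  moreover have "W A 1 `` {\<Phi>} \<subseteq> MC" for \<Phi>
    using W_subset by blast
  ultimately have "openin (MC_top \<A>) MC"
    unfolding openin_MC_top[OF assms] using zero_less_one by blast
  moreover have "topspace (MC_top \<A>) \<subseteq> MC"
    using openin_topspace[of "MC_top \<A>"] unfolding openin_MC_top[OF assms] by blast
  ultimately show ?thesis using openin_subset by blast
qed

definition covers :: "'a::topological_space set set \<Rightarrow> 'a set set set" where
  "covers \<A> = {\<U>. (\<forall>U\<in>\<U>. open U) \<and> \<Union>\<U> = UNIV \<and> {} \<notin> \<U> \<and> UNIV \<notin> \<U> \<and>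
     (\<forall>A\<in>\<A>. \<exists>U\<in>\<U>. A \<subseteq> U)}"

definition large_covers :: "'a::topological_space set set \<Rightarrow> 'a set set set" where
  "large_covers \<A> = {\<U> \<in> covers \<A>. \<forall>A\<in>\<A>. infinite {U \<in> \<U>. A \<subseteq> U}}"

definition clusters_at :: "'b topology \<Rightarrow> 'b \<Rightarrow> 'b set set" where
  "clusters_at Y y = {S. S \<subseteq> topspace Y \<and> y \<in> Y closure_of S}"

definition dense_sets :: "'b topology \<Rightarrow> 'b set set" where
  "dense_sets Y = {S. S \<subseteq> topspace Y \<and> Y closure_of S = topspace Y}"

text \<open>
  \<open>G1 \<C> \<D>\<close>: One plays members of \<open>\<C>\<close>, Two picks an element of each,
  and Two wins iff the set of the elements picked belongs to \<open>\<D>\<close>.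
\<close>

datatype 'm selection_game = G1 "'m set set" "'m set set"

text \<open>
  A strategy for One maps the list of Two's previous moves to the next move; a strategy for Two
  maps the list of One's moves, the current one being the last element, to the next move.
\<close>

fun I_wins :: "'m selection_game \<Rightarrow> bool" where
  "I_wins (G1 \<C> \<D>) \<longleftrightarrow>
     (\<exists>\<sigma>. (\<forall>h\<in>lists (\<Union>\<C>). \<sigma> h \<in> \<C>) \<and>
        (\<forall>x. (\<forall>n::nat. x n \<in> \<sigma> (map x [0..<n])) \<longrightarrow> range x \<notin> \<D>))"

fun II_wins :: "'m selection_game \<Rightarrow> bool" where
  "II_wins (G1 \<C> \<D>) \<longleftrightarrow>
     (\<exists>\<tau>. (\<forall>h\<in>lists \<C>. h \<noteq> [] \<longrightarrow> \<tau> h \<in> last h) \<and>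
        (\<forall>A. (\<forall>n::nat. A n \<in> \<C>) \<longrightarrow> range (\<lambda>n. \<tau> (map A [0..<Suc n])) \<in> \<D>))"

fun I_wins_pre :: "'m selection_game \<Rightarrow> bool" where
  "I_wins_pre (G1 \<C> \<D>) \<longleftrightarrow>
     (\<exists>A. (\<forall>n::nat. A n \<in> \<C>) \<and> (\<forall>x. (\<forall>n. x n \<in> A n) \<longrightarrow> range x \<notin> \<D>))"

fun II_wins_mark :: "'m selection_game \<Rightarrow> bool" where
  "II_wins_mark (G1 \<C> \<D>) \<longleftrightarrow>
     (\<exists>\<tau>. (\<forall>C\<in>\<C>. \<forall>n::nat. \<tau> C n \<in> C) \<and>
        (\<forall>A. (\<forall>n. A n \<in> \<C>) \<longrightarrow> range (\<lambda>n. \<tau> (A n) n) \<in> \<D>))"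

definition le_II :: "'m selection_game \<Rightarrow> 'k selection_game \<Rightarrow> bool" (infix "\<le>\<^sub>I\<^sub>I" 50) where
  "G \<le>\<^sub>I\<^sub>I H \<longleftrightarrow>
     (II_wins_mark G \<longrightarrow> II_wins_mark H) \<and>
     (II_wins G \<longrightarrow> II_wins H) \<and>
     (\<not> I_wins G \<longrightarrow> \<not> I_wins H) \<and>
     (\<not> I_wins_pre G \<longrightarrow> \<not> I_wins_pre H)"

definition game_equiv :: "'m selection_game \<Rightarrow> 'k selection_game \<Rightarrow> bool" where
  "game_equiv G H \<longleftrightarrow> G \<le>\<^sub>I\<^sub>I H \<and> H \<le>\<^sub>I\<^sub>I G"

end

theory Submission
  imports Defs
begin

text \<open>
  All three comparisons are instances of a transfer principle (\<open>le_II_transfer\<close>): if, inning by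
  inning, every move of One in \<open>H\<close> can be turned into a move of One in \<open>G\<close>, and every answer of Two to
  the latter can be turned back into an answer to the former, in such a way that winning plays of Two
  go to winning plays, then \<open>G \<le>\<^sub>I\<^sub>I H\<close>.

  (i) If \<open>\<F>\<close> clusters at \<open>zero_map\<close>, then for each \<open>\<epsilon> > 0\<close> the proper non-empty open sets, on which some
  member of \<open>\<F>\<close> has all its values in \<open>(-\<epsilon>, \<epsilon>)\<close>, form an \<open>\<A>\<close>-cover, by upper semicontinuity.
  In inning \<open>n\<close> take \<open>\<epsilon> = 1/(n+1)\<close>, and replace a chosen \<open>U\<close> by a map that is small on \<open>U\<close>.
  Largeness of the cover produced says that each \<open>B \<in> \<B>\<close> lies in \<open>U\<^sub>n\<close> for infinitely many \<open>n\<close>,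
  hence for some \<open>n\<close> with \<open>1/(n+1)\<close> as small as desired.

  (ii) A dense set clusters at \<open>zero_map\<close>.

  (iii) Given an \<open>\<A>\<close>-cover \<open>\<U>\<close>, the minimal cusco maps that are constantly \<open>{1}\<close> off some
  \<open>U \<in> \<U>\<close> are dense (\<open>one_off_dense\<close>). Indeed, given \<open>\<Phi>\<close> and \<open>A\<close>, \<open>\<A>\<close>-normality puts an open \<open>V\<close> with
  \<open>A \<subseteq> V \<subseteq> closure V \<subseteq> U\<close> between \<open>A\<close> and some \<open>U \<in> \<U>\<close>. There is a cusco map equal to \<open>\<Phi>\<close>
  on \<open>V\<close> and to \<open>{1}\<close> off \<open>closure V\<close> (\<open>MC_glue_const\<close>); a minimal cusco map below it still agrees with \<open>\<Phi>\<close> on \<open>V\<close>,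
  because minimality of a cusco map is inherited by open subspaces. Conversely, a map that is \<open>{1}\<close>
  off \<open>U\<close> can be \<open>1\<close>-close to \<open>zero_map\<close> on \<open>B\<close> only if \<open>B \<subseteq> U\<close>, so clustering at \<open>zero_map\<close> yields a
  \<open>\<B>\<close>-cover, and every \<open>\<B>\<close>-cover is large (\<open>covers_eq_large_covers\<close>).
\<close>

section \<open>Transfer of strategies\<close>

text \<open>
  The history in \<open>H\<close> that corresponds to a history in \<open>G\<close> when One follows \<open>\<sigma>\<close> in \<open>H\<close>. The history
  is consumed from its end, so it is fed in reversed.
\<close>

primrec translated_history ::
    "('k list \<Rightarrow> 'k set) \<Rightarrow> ('k set \<Rightarrow> nat \<Rightarrow> 'm \<Rightarrow> 'k) \<Rightarrow> 'm list \<Rightarrow> 'k list" where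
  "translated_history \<sigma> L [] = []"
| "translated_history \<sigma> L (x # h) =
     (let g = translated_history \<sigma> L h in g @ [L (\<sigma> g) (length h) x])"

text \<open>
  \<open>T\<close> carries One's moves from \<open>H\<close> to \<open>G\<close> and \<open>L\<close> carries Two's answers back. A strategy for Two in
  \<open>G\<close> is used in \<open>H\<close> by translating each move of One and answering through \<open>L\<close>; a strategy for One in
  \<open>H\<close> is used in \<open>G\<close> in the same way, with Two's answers translated before they are fed to it.
\<close>

lemma le_II_transfer:
  fixes T :: "'k set \<Rightarrow> nat \<Rightarrow> 'm set" and L :: "'k set \<Rightarrow> nat \<Rightarrow> 'm \<Rightarrow> 'k"
  assumes T: "\<And>C n. C \<in> \<C>' \<Longrightarrow> T C n \<in> \<C>"
    and L: "\<And>C n x. C \<in> \<C>' \<Longrightarrow> x \<in> T C n \<Longrightarrow> L C n x \<in> C"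
    and win: "\<And>C x. (\<And>n. C n \<in> \<C>') \<Longrightarrow> (\<And>n. x n \<in> T (C n) n) \<Longrightarrow> range x \<in> \<D> \<Longrightarrow>
                range (\<lambda>n. L (C n) n (x n)) \<in> \<D>'"
  shows "G1 \<C> \<D> \<le>\<^sub>I\<^sub>I G1 \<C>' \<D>'"
  unfolding le_II_def
proof (intro conjI)
  show "II_wins_mark (G1 \<C> \<D>) \<longrightarrow> II_wins_mark (G1 \<C>' \<D>')"
  proof
    assume "II_wins_mark (G1 \<C> \<D>)"
    then obtain \<tau> where \<tau>: "\<And>C n. C \<in> \<C> \<Longrightarrow> \<tau> C n \<in> C"
      and \<tau>_win: "\<And>A. (\<And>n::nat. A n \<in> \<C>) \<Longrightarrow> range (\<lambda>n. \<tau> (A n) n) \<in> \<D>"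
      by auto
    have "range (\<lambda>n. L (A n) n (\<tau> (T (A n) n) n)) \<in> \<D>'" if "\<And>n. A n \<in> \<C>'" for A
      using that T by (intro win \<tau> \<tau>_win) auto
    moreover have "L C n (\<tau> (T C n) n) \<in> C" if "C \<in> \<C>'" for C n
      using that by (intro L \<tau> T)
    ultimately show "II_wins_mark (G1 \<C>' \<D>')"
      unfolding II_wins_mark.simps
      by (intro exI[of _ "\<lambda>C n. L C n (\<tau> (T C n) n)"]) blast
  qed
next
  show "II_wins (G1 \<C> \<D>) \<longrightarrow> II_wins (G1 \<C>' \<D>')"
  proof
    assume "II_wins (G1 \<C> \<D>)"
    then obtain \<tau> where \<tau>: "\<And>h. h \<in> lists \<C> \<Longrightarrow> h \<noteq> [] \<Longrightarrow> \<tau> h \<in> last h"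
      and \<tau>_win: "\<And>A. (\<And>n::nat. A n \<in> \<C>) \<Longrightarrow> range (\<lambda>n. \<tau> (map A [0..<Suc n])) \<in> \<D>"
      by auto
    define tr where "tr h = map (\<lambda>i. T (h ! i) i) [0..<length h]" for h
    define \<tau>' where "\<tau>' h = L (last h) (length h - 1) (\<tau> (tr h))" for h
    have "\<tau>' h \<in> last h" if h: "h \<in> lists \<C>'" "h \<noteq> []" for h
    proof -
      have "tr h \<in> lists \<C>"
        using h T nth_mem unfolding tr_def by (fastforce simp: in_lists_conv_set)
      moreover have "tr h \<noteq> []" "last (tr h) = T (last h) (length h - 1)"
        using h by (auto simp: tr_def last_map last_conv_nth)
      ultimately have "\<tau> (tr h) \<in> T (last h) (length h - 1)"
        using \<tau>[of "tr h"] by simp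
      moreover have "last h \<in> \<C>'" using h by (simp add: in_lists_conv_set)
      ultimately show ?thesis unfolding \<tau>'_def by (intro L)
    qed
    moreover have "range (\<lambda>n. \<tau>' (map A [0..<Suc n])) \<in> \<D>'" if A: "\<And>n. A n \<in> \<C>'" for A
    proof -
      let ?B = "\<lambda>n. T (A n) n"
      have tr: "tr (map A [0..<Suc n]) = map ?B [0..<Suc n]" for n
        unfolding tr_def by (rule nth_equalityI) (auto simp: nth_append less_Suc_eq)
      have "\<tau>' (map A [0..<Suc n]) = L (A n) n (\<tau> (map ?B [0..<Suc n]))" for n
        unfolding \<tau>'_def tr by simp
      moreover have "range (\<lambda>n. L (A n) n (\<tau> (map ?B [0..<Suc n]))) \<in> \<D>'"
      proof (rule win[OF A])
        show "\<tau> (map ?B [0..<Suc n]) \<in> ?B n" for n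
        proof -
          have "map ?B [0..<Suc n] \<in> lists \<C>" using T[OF A] by fastforce
          then show ?thesis using \<tau>[of "map ?B [0..<Suc n]"] by simp
        qed
        show "range (\<lambda>n. \<tau> (map ?B [0..<Suc n])) \<in> \<D>"
          using T[OF A] by (intro \<tau>_win)
      qed
      ultimately show ?thesis by simp
    qed
    ultimately show "II_wins (G1 \<C>' \<D>')"
      unfolding II_wins.simps by blast
  qed
next
  have "I_wins (G1 \<C> \<D>)" if "I_wins (G1 \<C>' \<D>')"
  proof -
    from that[unfolded I_wins.simps] obtain \<sigma> where
      *: "(\<forall>h\<in>lists (\<Union>\<C>'). \<sigma> h \<in> \<C>') \<and>
          (\<forall>x. (\<forall>n::nat. x n \<in> \<sigma> (map x [0..<n])) \<longrightarrow> range x \<notin> \<D>')" ..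
    have \<sigma>: "\<sigma> h \<in> \<C>'" if "h \<in> lists (\<Union>\<C>')" for h
      using * that by (rule bspec[OF conjunct1])
    have \<sigma>_win: "range x \<notin> \<D>'" if "\<And>n. x n \<in> \<sigma> (map x [0..<n])" for x
      using conjunct2[OF *] that by (elim allE impE) (rule allI)
    define tr where "tr h = translated_history \<sigma> L (rev h)" for h
    \<comment> \<open>After an illegal answer of Two the translated history may leave \<open>H\<close>, where \<open>\<sigma>\<close>
        guarantees nothing; One then repeats the opening move.\<close>
    define legal where "legal h = (if tr h \<in> lists (\<Union>\<C>') then \<sigma> (tr h) else \<sigma> [])" for h
    define \<sigma>' where "\<sigma>' h = T (legal h) (length h)" for h
    have "legal h \<in> \<C>'" for h unfolding legal_def using \<sigma> by auto
    then have "\<sigma>' h \<in> \<C>" for h unfolding \<sigma>'_def by (intro T)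
    moreover have "range x \<notin> \<D>" if x: "\<And>n. x n \<in> \<sigma>' (map x [0..<n])" for x
    proof
      assume D: "range x \<in> \<D>"
      let ?g = "\<lambda>n. tr (map x [0..<n])"
      define y where "y n = L (\<sigma> (?g n)) n (x n)" for n
      have g: "?g n = map y [0..<n]" for n
        by (induction n) (simp_all add: tr_def y_def Let_def)
      have y: "y n \<in> \<sigma> (?g n) \<and> \<sigma> (?g n) \<in> \<C>' \<and> x n \<in> T (\<sigma> (?g n)) n" for n
      proof (induction n rule: less_induct)
        case (less n)
        then have "y i \<in> \<Union>\<C>'" if "i < n" for i using that by blast
        then have "?g n \<in> lists (\<Union>\<C>')" unfolding g by auto
        then have "\<sigma> (?g n) \<in> \<C>'" "x n \<in> T (\<sigma> (?g n)) n"
          using \<sigma> x[of n] by (simp_all add: \<sigma>'_def legal_def)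
        then show ?case using L[of "\<sigma> (?g n)" "x n" n] unfolding y_def[of n] by simp
      qed
      have "range y \<in> \<D>'"
        unfolding y_def using y D by (intro win) auto
      moreover have "range y \<notin> \<D>'"
        using y g by (intro \<sigma>_win) simp
      ultimately show False by contradiction
    qed
    ultimately show ?thesis unfolding I_wins.simps by blast
  qed
  then show "\<not> I_wins (G1 \<C> \<D>) \<longrightarrow> \<not> I_wins (G1 \<C>' \<D>')" by blast
next
  have "I_wins_pre (G1 \<C> \<D>)" if "I_wins_pre (G1 \<C>' \<D>')"
  proof -
    from that[unfolded I_wins_pre.simps] obtain A where
      *: "(\<forall>n::nat. A n \<in> \<C>') \<and> (\<forall>x. (\<forall>n. x n \<in> A n) \<longrightarrow> range x \<notin> \<D>')" ..
    have A: "A n \<in> \<C>'" for n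
      using * by blast
    have A_win: "range x \<notin> \<D>'" if "\<And>n. x n \<in> A n" for x
      using conjunct2[OF *] that by (elim allE impE) (rule allI)
    have "range x \<notin> \<D>" if x: "\<And>n. x n \<in> T (A n) n" for x
      using win[OF A x] A_win[of "\<lambda>n. L (A n) n (x n)"] L[OF A x] by blast
    then show ?thesis
      unfolding I_wins_pre.simps using T[OF A]
      by (intro exI[of _ "\<lambda>n. T (A n) n"]) blast
  qed
  then show "\<not> I_wins_pre (G1 \<C> \<D>) \<longrightarrow> \<not> I_wins_pre (G1 \<C>' \<D>')" by blast
qed

lemma le_II_trans: "G \<le>\<^sub>I\<^sub>I H \<Longrightarrow> H \<le>\<^sub>I\<^sub>I K \<Longrightarrow> G \<le>\<^sub>I\<^sub>I K"
  unfolding le_II_def by blast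

section \<open>Covers by an ideal\<close>

lemma closed_ideal_Un_finite:
  fixes \<A> :: "'a::t1_space set set"
  assumes "closed_ideal \<A>" "A \<in> \<A>" "finite F"
  shows "A \<union> F \<in> \<A>"
  using assms(3)
proof induction
  case empty
  then show ?case using assms(2) by simp
next
  case (insert x F)
  have "(A \<union> F) \<union> {x} \<in> \<A>"
    using assms(1) insert.IH unfolding closed_ideal_def by blast
  then show ?case by simp
qed

text \<open>
  If only finitely many members of a cover contained \<open>A\<close>, one could enlarge \<open>A\<close> by a point outside
  each of them; the result is still in the ideal, but lies in none of those members and hence in no
  member at all.
\<close>

lemma covers_eq_large_covers:
  fixes \<A> :: "'a::t1_space set set"
  assumes "closed_ideal \<A>"
  shows "covers \<A> = large_covers \<A>"
proof -
  have "infinite {U \<in> \<U>. A \<subseteq> U}" if U: "\<U> \<in> covers \<A>" and A: "A \<in> \<A>" for \<U> A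
  proof
    assume fin: "finite {U \<in> \<U>. A \<subseteq> U}"
    have "UNIV \<notin> \<U>" using U by (simp add: covers_def)
    then have "\<forall>U\<in>\<U>. \<exists>x. x \<notin> U" by (metis UNIV_eq_I)
    then obtain p where p: "\<And>U. U \<in> \<U> \<Longrightarrow> p U \<notin> U" by metis
    have "A \<union> p ` {U \<in> \<U>. A \<subseteq> U} \<in> \<A>"
      using closed_ideal_Un_finite[OF assms A] fin by blast
    then obtain U where "U \<in> \<U>" "A \<union> p ` {U \<in> \<U>. A \<subseteq> U} \<subseteq> U"
      using U unfolding covers_def by blast
    then show False using p by blast
  qed
  then show ?thesis unfolding large_covers_def by blast
qed

section \<open>Neighbourhoods in the space of minimal cusco maps\<close>

text \<open>
  Sections of entourages need not be open, but they are neighbourhoods: the points some section around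
  which fits into \<open>W A \<epsilon> `` {\<Phi>}\<close> form an open set, because entourages can be halved.
\<close>

lemma W_Image_neighbourhood:
  assumes "closed_ideal \<A>" "A \<in> \<A>" "\<epsilon> > 0" "\<Phi> \<in> MC"
  obtains N where "openin (MC_top \<A>) N" "\<Phi> \<in> N" "N \<subseteq> W A \<epsilon> `` {\<Phi>}"
proof
  let ?N = "{\<Psi> \<in> MC. \<exists>\<delta>>0. W A \<delta> `` {\<Psi>} \<subseteq> W A \<epsilon> `` {\<Phi>}}"
  have "W A (\<delta>/2) `` {\<Psi>} \<subseteq> ?N"
    if \<delta>: "\<delta> > 0" "W A \<delta> `` {\<Psi>} \<subseteq> W A \<epsilon> `` {\<Phi>}" for \<Psi> \<delta>
  proof
    fix \<Theta> assume \<Theta>: "\<Theta> \<in> W A (\<delta>/2) `` {\<Psi>}"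
    then have "\<Theta> \<in> MC" using W_subset by blast
    moreover have "W A (\<delta>/2) `` {\<Theta>} \<subseteq> W A \<epsilon> `` {\<Phi>}"
      using \<Theta> \<delta>(2) W_half[of A \<delta>] by blast
    ultimately show "\<Theta> \<in> ?N" using \<delta>(1) half_gt_zero by blast
  qed
  then show "openin (MC_top \<A>) ?N"
    unfolding openin_MC_top[OF assms(1)] using assms(2) half_gt_zero
    by (smt (verit) mem_Collect_eq subsetI)
  show "\<Phi> \<in> ?N" using assms by blast
  show "?N \<subseteq> W A \<epsilon> `` {\<Phi>}"
    using W_refl by blast
qed

lemma in_closure_of_MC_top_iff:
  assumes "closed_ideal \<A>"
  shows "\<Phi> \<in> MC_top \<A> closure_of S \<longleftrightarrow>
     \<Phi> \<in> MC \<and> (\<forall>A\<in>\<A>. \<forall>\<epsilon>>0. \<exists>\<Psi>\<in>S. (\<Phi>, \<Psi>) \<in> W A \<epsilon>)"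
proof (intro iffI conjI ballI allI impI)
  assume \<Phi>: "\<Phi> \<in> MC_top \<A> closure_of S"
  then show MC: "\<Phi> \<in> MC"
    by (simp add: in_closure_of topspace_MC_top[OF assms])
  fix A and \<epsilon> :: real assume "A \<in> \<A>" "\<epsilon> > 0"
  then obtain N where "openin (MC_top \<A>) N" "\<Phi> \<in> N" "N \<subseteq> W A \<epsilon> `` {\<Phi>}"
    using W_Image_neighbourhood[OF assms _ _ MC] by blast
  then show "\<exists>\<Psi>\<in>S. (\<Phi>, \<Psi>) \<in> W A \<epsilon>"
    using \<Phi> unfolding in_closure_of by blast
next
  assume h: "\<Phi> \<in> MC \<and> (\<forall>A\<in>\<A>. \<forall>\<epsilon>>0. \<exists>\<Psi>\<in>S. (\<Phi>, \<Psi>) \<in> W A \<epsilon>)"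
  then have "\<exists>\<Psi>. \<Psi> \<in> S \<and> \<Psi> \<in> N" if N: "openin (MC_top \<A>) N" "\<Phi> \<in> N" for N
    using N unfolding openin_MC_top[OF assms] by blast
  then show "\<Phi> \<in> MC_top \<A> closure_of S"
    using h by (auto simp: in_closure_of topspace_MC_top[OF assms])
qed

lemma MC_imp_cusco: "\<Phi> \<in> MC \<Longrightarrow> cusco \<Phi>"
  unfolding MC_def by blast

lemma MC_minimal:
  assumes "\<Phi> \<in> MC" "cusco \<Psi>" "\<And>x. \<Psi> x \<subseteq> \<Phi> x"
  shows "\<Psi> = \<Phi>"
proof -
  have "graph \<Psi> \<subseteq> graph \<Phi>" using assms(3) unfolding graph_def by blast
  then have "graph \<Psi> = graph \<Phi>" using assms(1,2) unfolding MC_def by blast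
  then show ?thesis unfolding graph_def by (auto simp: set_eq_iff)
qed

lemma MC_I:
  assumes "cusco \<Phi>" "\<And>\<Psi>. cusco \<Psi> \<Longrightarrow> (\<And>x. \<Psi> x \<subseteq> \<Phi> x) \<Longrightarrow> \<Psi> = \<Phi>"
  shows "\<Phi> \<in> MC"
  using assms unfolding MC_def graph_def by blast

lemma cusco_const:
  assumes "K \<noteq> {}" "compact K" "convex K"
  shows "cusco (\<lambda>x. K)"
  using assms unfolding cusco_def by auto

lemma zero_map_in_MC: "zero_map \<in> MC"
proof (rule MC_I)
  show "cusco zero_map" unfolding zero_map_def by (rule cusco_const) auto
  fix \<Psi> :: "'a \<Rightarrow> real set" assume \<Psi>: "cusco \<Psi>" "\<And>x. \<Psi> x \<subseteq> zero_map x"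
  show "\<Psi> = zero_map"
  proof
    fix x
    have "\<Psi> x \<noteq> {}" using \<Psi>(1) unfolding cusco_def by blast
    then show "\<Psi> x = zero_map x" using \<Psi>(2)[of x] unfolding zero_map_def by blast
  qed
qed

lemma zero_map_W_iff:
  assumes "\<Phi> \<in> MC"
  shows "(zero_map, \<Phi>) \<in> W A \<epsilon> \<longleftrightarrow> (\<forall>x\<in>A. \<Phi> x \<subseteq> ball 0 \<epsilon>)"
proof -
  have "0 \<in> (\<Union>y\<in>\<Phi> x. ball y \<epsilon>)" if "\<Phi> x \<subseteq> ball 0 \<epsilon>" for x
  proof -
    obtain y where y: "y \<in> \<Phi> x" using MC_imp_cusco[OF assms] unfolding cusco_def by blast
    then have "0 \<in> ball y \<epsilon>" using that by (auto simp: dist_commute)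
    then show ?thesis using y by blast
  qed
  then show ?thesis using assms zero_map_in_MC unfolding W_def zero_map_def by auto
qed

lemma clusters_at_zero_map_iff:
  assumes "closed_ideal \<A>"
  shows "S \<in> clusters_at (MC_top \<A>) zero_map \<longleftrightarrow>
     S \<subseteq> MC \<and> (\<forall>A\<in>\<A>. \<forall>\<epsilon>>0. \<exists>\<Phi>\<in>S. \<forall>x\<in>A. \<Phi> x \<subseteq> ball 0 \<epsilon>)"
proof -
  have "(\<exists>\<Phi>\<in>S. (zero_map, \<Phi>) \<in> W A \<epsilon>) \<longleftrightarrow> (\<exists>\<Phi>\<in>S. \<forall>x\<in>A. \<Phi> x \<subseteq> ball 0 \<epsilon>)"
    if "S \<subseteq> MC" for A \<epsilon>
    using that zero_map_W_iff by blast
  then show ?thesis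
    using zero_map_in_MC
    unfolding clusters_at_def mem_Collect_eq topspace_MC_top[OF assms]
      in_closure_of_MC_top_iff[OF assms] by auto
qed

section \<open>Gluing and minimizing cusco maps\<close>

text \<open>
  Replacing \<open>\<Phi>\<close> by smaller values on an open set keeps it upper semicontinuous: the points whose
  new value lies in \<open>U\<close> are those whose old value lies in \<open>U\<close>, together with an open part of \<open>V\<close>.
\<close>

lemma cusco_glue:
  assumes "cusco \<Phi>" "cusco \<Psi>" "open V" "\<And>x. x \<in> V \<Longrightarrow> \<Psi> x \<subseteq> \<Phi> x"
  shows "cusco (\<lambda>x. if x \<in> V then \<Psi> x else \<Phi> x)"
  unfolding cusco_def
proof (intro conjI allI impI)
  fix U :: "real set" assume U: "open U"
  have "{x. (if x \<in> V then \<Psi> x else \<Phi> x) \<subseteq> U} = {x. \<Phi> x \<subseteq> U} \<union> ({x. \<Psi> x \<subseteq> U} \<inter> V)"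
    using assms(4) by auto
  then show "open {x. (if x \<in> V then \<Psi> x else \<Phi> x) \<subseteq> U}"
    using assms(1-3) U unfolding cusco_def by (simp add: open_Un open_Int)
qed (use assms(1,2) in \<open>auto simp: cusco_def\<close>)

text \<open>
  Minimality is local: a cusco map strictly below \<open>\<Phi>\<close> somewhere on \<open>V\<close> could be glued into \<open>\<Phi>\<close>
  along \<open>V\<close> and would give a cusco map strictly below \<open>\<Phi>\<close>.
\<close>

lemma MC_minimal_on_open:
  assumes "\<Phi> \<in> MC" "cusco \<Psi>" "open V" "\<And>x. x \<in> V \<Longrightarrow> \<Psi> x \<subseteq> \<Phi> x" "x \<in> V"
  shows "\<Psi> x = \<Phi> x"
proof -
  have "(\<lambda>x. if x \<in> V then \<Psi> x else \<Phi> x) = \<Phi>"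
    using assms(4)
    by (intro MC_minimal[OF assms(1)] cusco_glue[OF MC_imp_cusco[OF assms(1)] assms(2,3)]) auto
  from fun_cong[OF this, of x] show ?thesis using assms(5) by simp
qed

lemma compact_chain_Inter_subset_open:
  fixes \<K> :: "real set set"
  assumes "\<K> \<noteq> {}" "\<And>K. K \<in> \<K> \<Longrightarrow> compact K"
    "\<And>K L. K \<in> \<K> \<Longrightarrow> L \<in> \<K> \<Longrightarrow> K \<subseteq> L \<or> L \<subseteq> K"
    and "open V" "\<Inter>\<K> \<subseteq> V"
  shows "\<exists>K\<in>\<K>. K \<subseteq> V"
proof (rule ccontr)
  assume *: "\<not> ?thesis"
  have "\<Inter>((\<lambda>K. K - V) ` \<K>) \<noteq> {}"
  proof (rule compact_chain)
    show "compact S" if "S \<in> (\<lambda>K. K - V) ` \<K>" for S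
      using that assms(2,4) by (auto intro: compact_diff)
    show "{} \<notin> (\<lambda>K. K - V) ` \<K>" using * by blast
    show "S \<subseteq> T \<or> T \<subseteq> S" if "S \<in> (\<lambda>K. K - V) ` \<K> \<and> T \<in> (\<lambda>K. K - V) ` \<K>" for S T
      using that assms(3) by blast
  qed
  then show False using assms(1,5) by blast
qed

text \<open>
  Zorn's lemma: by compactness the pointwise intersection of a chain of cusco maps has non-empty
  values, and where it lies in an open set, some member of the chain already does.
\<close>

lemma cusco_contains_MC:
  assumes "cusco \<Phi>"
  obtains \<Psi> where "\<Psi> \<in> MC" "\<And>x. \<Psi> x \<subseteq> \<Phi> x"
proof -
  let ?S = "{\<Psi>. cusco \<Psi> \<and> (\<forall>x. \<Psi> x \<subseteq> \<Phi> x)}"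
  let ?r = "\<lambda>\<Psi> \<Theta>. \<forall>x. \<Theta> x \<subseteq> \<Psi> x"
  have "\<exists>\<Psi>\<in>?S. \<forall>\<Theta>\<in>?S. ?r \<Psi> \<Theta> \<longrightarrow> \<Theta> = \<Psi>"
  proof (rule predicate_Zorn)
    show "partial_order_on ?S (relation_of ?r ?S)"
      by (rule partial_order_on_relation_ofI) (auto simp: fun_eq_iff)
    fix C assume "C \<in> Chains (relation_of ?r ?S)"
    then have C: "C \<subseteq> ?S" "\<And>\<Psi> \<Theta>. \<Psi> \<in> C \<Longrightarrow> \<Theta> \<in> C \<Longrightarrow> ?r \<Psi> \<Theta> \<or> ?r \<Theta> \<Psi>"
      unfolding Chains_def relation_of_def by blast+
    show "\<exists>\<Theta>\<in>?S. \<forall>\<Psi>\<in>C. ?r \<Psi> \<Theta>"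
    proof (cases "C = {}")
      case True
      then show ?thesis using assms by blast
    next
      case False
      define \<Theta> where "\<Theta> x = \<Inter>((\<lambda>\<Psi>. \<Psi> x) ` C)" for x
      have val: "\<Psi> x \<noteq> {}" "compact (\<Psi> x)" "convex (\<Psi> x)" if "\<Psi> \<in> C" for \<Psi> x
        using that C(1) unfolding cusco_def by blast+
      have lin: "K \<subseteq> L \<or> L \<subseteq> K" if "K \<in> (\<lambda>\<Psi>. \<Psi> x) ` C" "L \<in> (\<lambda>\<Psi>. \<Psi> x) ` C" for K L x
        using that C(2) by blast
      have small: "\<Theta> x \<subseteq> V \<longleftrightarrow> (\<exists>\<Psi>\<in>C. \<Psi> x \<subseteq> V)" if "open V" for V x
      proof
        assume "\<Theta> x \<subseteq> V"
        then have "\<exists>K\<in>(\<lambda>\<Psi>. \<Psi> x) ` C. K \<subseteq> V"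
          using False val lin that unfolding \<Theta>_def
          by (intro compact_chain_Inter_subset_open) auto
        then show "\<exists>\<Psi>\<in>C. \<Psi> x \<subseteq> V" by blast
      qed (auto simp: \<Theta>_def)
      have "cusco \<Theta>"
        unfolding cusco_def
      proof (intro conjI allI impI)
        fix x
        show "\<Theta> x \<noteq> {}" using small[of "{}" x] val(1) by auto
        show "compact (\<Theta> x)"
          unfolding \<Theta>_def using False val(2) by (intro compact_Inter) auto
        show "convex (\<Theta> x)"
          unfolding \<Theta>_def using val(3) by (intro convex_Inter) auto
      next
        fix V :: "real set" assume V: "open V"
        then have "{x. \<Theta> x \<subseteq> V} = (\<Union>\<Psi>\<in>C. {x. \<Psi> x \<subseteq> V})"
          by (auto simp: small)
        then show "open {x. \<Theta> x \<subseteq> V}"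
          using C(1) V unfolding cusco_def by (auto intro!: open_UN)
      qed
      moreover have "\<Theta> x \<subseteq> \<Psi> x" if "\<Psi> \<in> C" for \<Psi> x using that unfolding \<Theta>_def by blast
      moreover have "\<Theta> x \<subseteq> \<Phi> x" for x using False C(1) unfolding \<Theta>_def by blast
      ultimately show ?thesis by blast
    qed
  qed
  then obtain \<Psi> where \<Psi>: "cusco \<Psi>" "\<And>x. \<Psi> x \<subseteq> \<Phi> x"
    and min: "\<And>\<Theta>. cusco \<Theta> \<Longrightarrow> (\<And>x. \<Theta> x \<subseteq> \<Phi> x) \<Longrightarrow> (\<And>x. \<Theta> x \<subseteq> \<Psi> x) \<Longrightarrow> \<Theta> = \<Psi>"
    by auto
  have "\<Psi> \<in> MC"
    using \<Psi> by (intro MC_I min) (auto dest: subsetD)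
  then show ?thesis using \<Psi>(2) that by blast
qed

text \<open>
  A compact convex subset of an open set has a convex open neighbourhood inside it, and the hull stays
  in that neighbourhood as long as the values of \<open>\<Phi>\<close> and \<open>c\<close> do.
\<close>

lemma cusco_hull_insert:
  assumes "cusco \<Phi>"
  shows "cusco (\<lambda>x. convex hull (insert c (\<Phi> x)))"
  unfolding cusco_def
proof (intro conjI allI impI)
  fix x
  show "convex hull insert c (\<Phi> x) \<noteq> {}" by simp
  show comp: "compact (convex hull insert c (\<Phi> x))" for x
    using assms unfolding cusco_def by (intro compact_convex_hull compact_insert) blast
  show "convex (convex hull insert c (\<Phi> x))" by (rule convex_convex_hull)
  fix V :: "real set" assume V: "open V"
  show "open {x. convex hull insert c (\<Phi> x) \<subseteq> V}"
  proof (subst open_subopen, clarify)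
    fix x assume x: "convex hull insert c (\<Phi> x) \<subseteq> V"
    let ?K = "convex hull insert c (\<Phi> x)"
    obtain e where e: "e > 0" "(\<Union>y\<in>?K. ball y e) \<subseteq> V"
      using compact_subset_open_imp_ball_epsilon_subset[OF comp V x] by blast
    define O' where "O' = (\<Union>y\<in>?K. ball y e)"
    have ball_eq: "ball y e = (\<Union>b\<in>ball 0 e. {y + b})" for y :: real
      using ball_translation[of y 0 e] by (simp add: UNION_singleton_eq_range)
    have "O' = (\<Union>a\<in>?K. \<Union>b\<in>ball 0 e. {a + b})"
      unfolding O'_def by (rule SUP_cong[OF refl ball_eq])
    then have conv: "convex O'"
      using convex_sums[OF convex_convex_hull convex_ball] by simp
    have "?K \<subseteq> O'" unfolding O'_def using e(1) centre_in_ball by blast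
    then have sub: "\<Phi> x \<subseteq> O'" "c \<in> O'" using hull_subset[of "insert c (\<Phi> x)" convex] by auto
    have "open O'" unfolding O'_def by auto
    then have "open {y. \<Phi> y \<subseteq> O'}" using assms unfolding cusco_def by blast
    moreover have "convex hull insert c (\<Phi> y) \<subseteq> V" if "\<Phi> y \<subseteq> O'" for y
      using hull_minimal[of "insert c (\<Phi> y)" O' convex] that sub(2) conv e(2)
      unfolding O'_def by blast
    ultimately show "\<exists>T. open T \<and> x \<in> T \<and> T \<subseteq> {x. convex hull insert c (\<Phi> x) \<subseteq> V}"
      using sub(1) by blast
  qed
qed

text \<open>
  The hull of \<open>\<Phi>\<close> and \<open>c\<close> is a cusco map above both, so \<open>\<Phi>\<close> can be glued into it on \<open>V\<close> and \<open>{c}\<close> off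
  the closure of \<open>V\<close>. Passing to a minimal map below alters neither piece, since both are minimal on the
  open sets where they live; only the values on the frontier of \<open>V\<close> shrink.
\<close>

lemma MC_glue_const:
  assumes "\<Phi> \<in> MC" "open V"
  obtains \<Psi> where "\<Psi> \<in> MC" "\<And>x. x \<in> V \<Longrightarrow> \<Psi> x = \<Phi> x" "\<And>x. x \<notin> closure V \<Longrightarrow> \<Psi> x = {c}"
proof -
  define H where "H x = convex hull (insert c (\<Phi> x))" for x
  have sub: "\<Phi> x \<subseteq> H x" "{c} \<subseteq> H x" for x
    unfolding H_def using hull_subset[of "insert c (\<Phi> x)" convex] by auto
  define P where "P x = (if x \<in> V then \<Phi> x else H x)" for x
  define Q where "Q x = (if x \<in> - closure V then {c} else P x)" for x
  have "cusco H"
    unfolding H_def using assms(1) by (intro cusco_hull_insert MC_imp_cusco)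
  then have "cusco P"
    unfolding P_def using assms sub(1) by (auto intro!: cusco_glue dest: MC_imp_cusco)
  moreover have "{c} \<subseteq> P x" if "x \<in> - closure V" for x
    using that sub(2) closure_subset[of V] unfolding P_def by auto
  ultimately have "cusco Q"
    unfolding Q_def by (intro cusco_glue cusco_const) auto
  then obtain \<Psi> where \<Psi>: "\<Psi> \<in> MC" "\<And>x. \<Psi> x \<subseteq> Q x"
    using cusco_contains_MC by blast
  have QV: "Q x = \<Phi> x" if "x \<in> V" for x
    using that closure_subset[of V] unfolding Q_def P_def by auto
  have "\<Psi> x = \<Phi> x" if "x \<in> V" for x
    using MC_minimal_on_open[OF assms(1) MC_imp_cusco[OF \<Psi>(1)] assms(2) _ that] \<Psi>(2) QV
    by blast
  moreover have "\<Psi> x = {c}" if "x \<notin> closure V" for x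
  proof -
    have "\<Psi> x \<noteq> {}" using MC_imp_cusco[OF \<Psi>(1)] unfolding cusco_def by blast
    moreover have "\<Psi> x \<subseteq> {c}" using \<Psi>(2)[of x] that unfolding Q_def by simp
    ultimately show ?thesis by blast
  qed
  ultimately show ?thesis using \<Psi>(1) that by blast
qed

section \<open>The translations between the games\<close>

text \<open>
  Admitting all proper open subsets of \<open>{x. \<Phi> x \<subseteq> ball 0 \<epsilon>}\<close>, rather than these sets themselves,
  covers the case that some \<open>\<Phi> \<in> \<F>\<close> is small on the whole space.
\<close>

definition smallness_cover ::
    "('a::topological_space \<Rightarrow> real set) set \<Rightarrow> real \<Rightarrow> 'a set set" where
  "smallness_cover \<F> \<epsilon> =
     {U. open U \<and> U \<noteq> {} \<and> U \<noteq> UNIV \<and> (\<exists>\<Phi>\<in>\<F>. \<forall>x\<in>U. \<Phi> x \<subseteq> ball 0 \<epsilon>)}"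

lemma smallness_cover_in_covers:
  fixes \<A> :: "'a::t1_space set set"
  assumes ideal: "closed_ideal \<A>" and F: "\<F> \<in> clusters_at (MC_top \<A>) zero_map" and "\<epsilon> > 0"
  shows "smallness_cover \<F> \<epsilon> \<in> covers \<A>"
proof -
  have A: "\<exists>U\<in>smallness_cover \<F> \<epsilon>. A \<subseteq> U" if "A \<in> \<A>" for A
  proof -
    have "\<exists>\<Phi>\<in>\<F>. \<forall>x\<in>A. \<Phi> x \<subseteq> ball 0 \<epsilon>" and sub: "\<F> \<subseteq> MC"
      using F that \<open>\<epsilon> > 0\<close> by (simp_all add: clusters_at_zero_map_iff[OF ideal] del: mem_ball)
    then obtain \<Phi> where \<Phi>: "\<Phi> \<in> \<F>" "\<forall>x\<in>A. \<Phi> x \<subseteq> ball 0 \<epsilon>" by blast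
    have "A \<noteq> UNIV" "A \<noteq> {}" using ideal that by (auto simp: closed_ideal_def)
    then obtain p where p: "p \<notin> A" by blast
    \<comment> \<open>Deleting \<open>p\<close> makes the set proper, and leaves it open as points are closed.\<close>
    let ?U = "{x. \<Phi> x \<subseteq> ball 0 \<epsilon>} - {p}"
    have "open {x. \<Phi> x \<subseteq> ball 0 \<epsilon>}"
      using \<Phi>(1) sub MC_imp_cusco unfolding cusco_def by blast
    then have "open ?U" by (rule open_Diff) simp
    moreover have "A \<subseteq> ?U" using \<Phi>(2) p by blast
    moreover have "?U \<noteq> {}" "?U \<noteq> UNIV" using \<open>A \<subseteq> ?U\<close> \<open>A \<noteq> {}\<close> by blast+
    moreover have "\<forall>x\<in>?U. \<Phi> x \<subseteq> ball 0 \<epsilon>" by blast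
    ultimately have "?U \<in> smallness_cover \<F> \<epsilon>"
      unfolding smallness_cover_def using \<Phi>(1) by blast
    then show ?thesis using \<open>A \<subseteq> ?U\<close> by blast
  qed
  have "{x} \<in> \<A>" for x using ideal unfolding closed_ideal_def by blast
  then have "\<Union>(smallness_cover \<F> \<epsilon>) = UNIV" using A by blast
  moreover have "\<forall>U\<in>smallness_cover \<F> \<epsilon>. open U"
    "{} \<notin> smallness_cover \<F> \<epsilon>" "UNIV \<notin> smallness_cover \<F> \<epsilon>"
    unfolding smallness_cover_def by auto
  ultimately show ?thesis using A unfolding covers_def by simp
qed

lemma covers_le_clusters:
  fixes \<A> \<B> :: "'a::t1_space set set"
  assumes "closed_ideal \<A>" "closed_ideal \<B>"
  shows "G1 (covers \<A>) (large_covers \<B>)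
           \<le>\<^sub>I\<^sub>I G1 (clusters_at (MC_top \<A>) zero_map) (clusters_at (MC_top \<B>) zero_map)"
proof -
  let ?e = "\<lambda>n. inverse (real (Suc n))"
  define L :: "('a \<Rightarrow> real set) set \<Rightarrow> nat \<Rightarrow> 'a set \<Rightarrow> ('a \<Rightarrow> real set)"
    where "L \<F> n U = (SOME \<Phi>. \<Phi> \<in> \<F> \<and> (\<forall>x\<in>U. \<Phi> x \<subseteq> ball 0 (?e n)))" for \<F> n U
  have L: "L \<F> n U \<in> \<F> \<and> (\<forall>x\<in>U. L \<F> n U x \<subseteq> ball 0 (?e n))"
    if "U \<in> smallness_cover \<F> (?e n)" for \<F> n U
  proof -
    have "\<exists>\<Phi>. \<Phi> \<in> \<F> \<and> (\<forall>x\<in>U. \<Phi> x \<subseteq> ball 0 (?e n))"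
      using that unfolding smallness_cover_def by blast
    then show ?thesis unfolding L_def by (rule someI_ex)
  qed
  show ?thesis
  proof (rule le_II_transfer[where T = "\<lambda>\<F> n. smallness_cover \<F> (?e n)" and L = L])
    show "smallness_cover \<F> (?e n) \<in> covers \<A>"
      if "\<F> \<in> clusters_at (MC_top \<A>) zero_map" for \<F> n
      using smallness_cover_in_covers[OF assms(1) that] by simp
    show "L \<F> n U \<in> \<F>" if "U \<in> smallness_cover \<F> (?e n)" for \<F> n U
      using L[OF that] by blast
    fix \<F> :: "nat \<Rightarrow> ('a \<Rightarrow> real set) set" and U :: "nat \<Rightarrow> 'a set"
    assume F: "\<And>n. \<F> n \<in> clusters_at (MC_top \<A>) zero_map"
      and U: "\<And>n. U n \<in> smallness_cover (\<F> n) (?e n)" and large: "range U \<in> large_covers \<B>"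
    have LU: "L (\<F> n) n (U n) \<in> \<F> n" "\<forall>x\<in>U n. L (\<F> n) n (U n) x \<subseteq> ball 0 (?e n)" for n
      using L[OF U] by blast+
    show "range (\<lambda>n. L (\<F> n) n (U n)) \<in> clusters_at (MC_top \<B>) zero_map"
      unfolding clusters_at_zero_map_iff[OF assms(2)]
    proof (intro conjI ballI allI impI)
      have "\<F> n \<subseteq> MC" for n
        using F[of n] by (simp add: clusters_at_zero_map_iff[OF assms(1)])
      then show "range (\<lambda>n. L (\<F> n) n (U n)) \<subseteq> MC" using LU(1) by blast
      fix B and \<epsilon> :: real assume B: "B \<in> \<B>" and "\<epsilon> > 0"
      obtain N where N: "?e N < \<epsilon>" using reals_Archimedean[OF \<open>\<epsilon> > 0\<close>] by blast
      \<comment> \<open>Infinitely many distinct sets contain \<open>B\<close>, so they occur in arbitrarily late innings.\<close>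
      have "infinite {V \<in> range U. B \<subseteq> V}" using large B unfolding large_covers_def by blast
      moreover have "{V \<in> range U. B \<subseteq> V} = U ` {n. B \<subseteq> U n}" by blast
      ultimately have "infinite {n. B \<subseteq> U n}" by (metis finite_imageI)
      then obtain n where n: "n \<ge> N" "B \<subseteq> U n"
        unfolding infinite_nat_iff_unbounded_le by blast
      have "?e n \<le> ?e N" using n(1) by (simp add: le_imp_inverse_le)
      then have "?e n \<le> \<epsilon>" using N by linarith
      then have "ball 0 (?e n) \<subseteq> (ball 0 \<epsilon> :: real set)" by (rule subset_ball)
      then have "\<forall>x\<in>B. L (\<F> n) n (U n) x \<subseteq> ball 0 \<epsilon>" using LU(2)[of n] n(2) by blast
      then show "\<exists>\<Phi>\<in>range (\<lambda>n. L (\<F> n) n (U n)). \<forall>x\<in>B. \<Phi> x \<subseteq> ball 0 \<epsilon>" by blast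
    qed
  qed
qed

lemma dense_sets_subset_clusters_at:
  assumes "y \<in> topspace Y"
  shows "dense_sets Y \<subseteq> clusters_at Y y"
  using assms unfolding dense_sets_def clusters_at_def by auto

lemma clusters_le_dense:
  assumes "closed_ideal \<A>"
  shows "G1 (clusters_at (MC_top \<A>) zero_map) \<D> \<le>\<^sub>I\<^sub>I G1 (dense_sets (MC_top \<A>)) \<D>"
proof -
  have "dense_sets (MC_top \<A>) \<subseteq> clusters_at (MC_top \<A>) zero_map"
    using zero_map_in_MC by (intro dense_sets_subset_clusters_at) (simp add: topspace_MC_top[OF assms])
  then show ?thesis
    by (intro le_II_transfer[where T = "\<lambda>C n. C" and L = "\<lambda>C n x. x"]) auto
qed

definition one_off :: "'a::topological_space set set \<Rightarrow> ('a \<Rightarrow> real set) set" where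
  "one_off \<U> = {\<Phi> \<in> MC. \<exists>U\<in>\<U>. \<forall>x. x \<notin> U \<longrightarrow> \<Phi> x = {1}}"

lemma one_off_dense:
  assumes ideal: "closed_ideal \<A>" and "ideal_normal \<A>" and \<U>: "\<U> \<in> covers \<A>"
  shows "one_off \<U> \<in> dense_sets (MC_top \<A>)"
proof -
  have "\<exists>\<Psi>\<in>one_off \<U>. (\<Phi>, \<Psi>) \<in> W A \<epsilon>" if \<Phi>: "\<Phi> \<in> MC" and A: "A \<in> \<A>" and "\<epsilon> > 0" for \<Phi> A \<epsilon>
  proof -
    obtain U where U: "U \<in> \<U>" "A \<subseteq> U" "open U" using \<U> A unfolding covers_def by blast
    then have "\<exists>V. open V \<and> A \<subseteq> V \<and> closure V \<subseteq> U"
      using assms(2) A by (simp add: ideal_normal_def)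
    then obtain V where V: "open V" "A \<subseteq> V" "closure V \<subseteq> U" by blast
    obtain \<Psi> where \<Psi>: "\<Psi> \<in> MC" "\<And>x. x \<in> V \<Longrightarrow> \<Psi> x = \<Phi> x" "\<And>x. x \<notin> closure V \<Longrightarrow> \<Psi> x = {1}"
      using MC_glue_const[OF \<Phi> V(1)] by blast
    have "\<Psi> \<in> one_off \<U>" using \<Psi>(1,3) U(1) V(3) unfolding one_off_def by blast
    moreover have "(\<Phi>, \<Phi>) \<in> W A \<epsilon>" using W_refl[OF \<open>\<epsilon> > 0\<close>] \<Phi> by blast
    then have "(\<Phi>, \<Psi>) \<in> W A \<epsilon>" using \<Psi>(1,2) V(2) by (auto simp: W_def subset_iff)
    ultimately show ?thesis by blast
  qed
  then have "MC \<subseteq> MC_top \<A> closure_of one_off \<U>"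
    unfolding in_closure_of_MC_top_iff[OF ideal] subset_iff by blast
  moreover have "MC_top \<A> closure_of one_off \<U> \<subseteq> MC"
    using in_closure_of_MC_top_iff[OF ideal] by blast
  ultimately show ?thesis
    unfolding dense_sets_def one_off_def topspace_MC_top[OF ideal] by blast
qed

lemma dense_le_covers:
  fixes \<A> \<B> :: "'a::t1_space set set"
  assumes "closed_ideal \<A>" "closed_ideal \<B>" "ideal_normal \<A>"
  shows "G1 (dense_sets (MC_top \<A>)) (clusters_at (MC_top \<B>) zero_map)
           \<le>\<^sub>I\<^sub>I G1 (covers \<A>) (large_covers \<B>)"
proof -
  define L :: "'a set set \<Rightarrow> nat \<Rightarrow> ('a \<Rightarrow> real set) \<Rightarrow> 'a set"
    where "L \<U> n \<Phi> = (SOME U. U \<in> \<U> \<and> (\<forall>x. x \<notin> U \<longrightarrow> \<Phi> x = {1}))" for \<U> n \<Phi>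
  have L: "L \<U> n \<Phi> \<in> \<U> \<and> (\<forall>x. x \<notin> L \<U> n \<Phi> \<longrightarrow> \<Phi> x = {1})" if "\<Phi> \<in> one_off \<U>" for \<U> n \<Phi>
  proof -
    have "\<exists>U. U \<in> \<U> \<and> (\<forall>x. x \<notin> U \<longrightarrow> \<Phi> x = {1})"
      using that unfolding one_off_def by blast
    then show ?thesis unfolding L_def by (rule someI_ex)
  qed
  show ?thesis
  proof (rule le_II_transfer[where T = "\<lambda>\<U> n. one_off \<U>" and L = L])
    show "one_off \<U> \<in> dense_sets (MC_top \<A>)" if "\<U> \<in> covers \<A>" for \<U>
      using one_off_dense[OF assms(1,3) that] .
    show "L \<U> n \<Phi> \<in> \<U>" if "\<Phi> \<in> one_off \<U>" for \<U> n \<Phi>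
      using L[OF that] by blast
    fix \<U> :: "nat \<Rightarrow> 'a set set" and \<Phi> :: "nat \<Rightarrow> 'a \<Rightarrow> real set"
    assume U: "\<And>n. \<U> n \<in> covers \<A>" and \<Phi>: "\<And>n. \<Phi> n \<in> one_off (\<U> n)"
      and cl: "range \<Phi> \<in> clusters_at (MC_top \<B>) zero_map"
    define V where "V n = L (\<U> n) n (\<Phi> n)" for n
    have V: "V n \<in> \<U> n" "\<And>x. x \<notin> V n \<Longrightarrow> \<Phi> n x = {1}" for n
      unfolding V_def using L[OF \<Phi>] by blast+
    have B: "\<exists>U\<in>range V. B \<subseteq> U" if "B \<in> \<B>" for B
    proof -
      have "\<exists>\<Psi>\<in>range \<Phi>. \<forall>x\<in>B. \<Psi> x \<subseteq> ball 0 1"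
        using cl that zero_less_one by (simp only: clusters_at_zero_map_iff[OF assms(2)])
      then obtain n where "\<forall>x\<in>B. \<Phi> n x \<subseteq> ball 0 1" by blast
      then have "B \<subseteq> V n" using V(2)[of _ n] by fastforce
      then show ?thesis by blast
    qed
    moreover have "{x} \<in> \<B>" for x using assms(2) unfolding closed_ideal_def by blast
    ultimately have "\<Union>(range V) = UNIV" by blast
    moreover have "open (V n) \<and> V n \<noteq> {} \<and> V n \<noteq> UNIV" for n
    proof -
      have "\<forall>U\<in>\<U> n. open U" "{} \<notin> \<U> n" "UNIV \<notin> \<U> n"
        using U[of n] by (simp_all add: covers_def)
      then show ?thesis using V(1)[of n] by metis
    qed
    then have "(\<forall>U\<in>range V. open U)" "{} \<notin> range V" "UNIV \<notin> range V" by fastforce+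
    ultimately have "range V \<in> covers \<B>" using B unfolding covers_def by simp
    then show "range (\<lambda>n. L (\<U> n) n (\<Phi> n)) \<in> large_covers \<B>"
      unfolding covers_eq_large_covers[OF assms(2)] V_def .
  qed
qed

theorem theorem32:
  fixes \<A> \<B> :: "'a::t3_space set set"
  assumes "closed_ideal \<A>" and "closed_ideal \<B>"
  shows "G1 (covers \<A>) (large_covers \<B>)
           \<le>\<^sub>I\<^sub>I G1 (clusters_at (MC_top \<A>) zero_map) (clusters_at (MC_top \<B>) zero_map) \<and>
         G1 (clusters_at (MC_top \<A>) zero_map) (clusters_at (MC_top \<B>) zero_map)
           \<le>\<^sub>I\<^sub>I G1 (dense_sets (MC_top \<A>)) (clusters_at (MC_top \<B>) zero_map) \<and>
         (ideal_normal \<A> \<longrightarrow>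
           G1 (dense_sets (MC_top \<A>)) (clusters_at (MC_top \<B>) zero_map)
             \<le>\<^sub>I\<^sub>I G1 (covers \<A>) (large_covers \<B>)) \<and>
         (ideal_normal \<A> \<longrightarrow>
           game_equiv (G1 (covers \<A>) (large_covers \<B>))
             (G1 (clusters_at (MC_top \<A>) zero_map) (clusters_at (MC_top \<B>) zero_map)) \<and>
           game_equiv (G1 (clusters_at (MC_top \<A>) zero_map) (clusters_at (MC_top \<B>) zero_map))
             (G1 (dense_sets (MC_top \<A>)) (clusters_at (MC_top \<B>) zero_map)) \<and>
           game_equiv (G1 (covers \<A>) (large_covers \<B>))
             (G1 (dense_sets (MC_top \<A>)) (clusters_at (MC_top \<B>) zero_map)))"
proof -
  note covers_clusters = covers_le_clusters[OF assms]
  note clusters_dense = clusters_le_dense[OF assms(1), of "clusters_at (MC_top \<B>) zero_map"]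
  note dense_covers = dense_le_covers[OF assms]
  note covers_dense = le_II_trans[OF covers_clusters clusters_dense]
  note clusters_covers = le_II_trans[OF clusters_dense dense_covers]
  note dense_clusters = le_II_trans[OF dense_covers covers_clusters]
  show ?thesis
    unfolding game_equiv_def
    by (intro conjI impI covers_clusters clusters_dense dense_covers
        covers_dense clusters_covers dense_clusters)
qed

end
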